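(* Let $\alpha$ be a positive real number. Suppose $u:[0,1]\to\mathbb{R}$ is a measurable function such that $$u(1-x)+(1-x)^\alpha\, u\!\left(\frac{y}{1-x}\right) = u(y) + (1-y)^\alpha\, u\!\left(\frac{1-x-y}{1-y}\right)$$ for all $x,y\in[0,1)$ with $x+y\in[0,1]$. Then $u$ is infinitely differentiable on the open interval $(0,1)$.
   Context: Measurable means Lebesgue measurable. Since $\alpha>0$, $0^\alpha=0$. *)

theory Defs
  imports "HOL-Analysis.Analysis"
begin

text \<open>
  Intended for open \<open>S\<close>: there the iterates of \<^const>\<open>deriv\<close> at points of \<open>S\<close> are the genuine
  iterated derivatives and depend only on the values of \<open>f\<close> on \<open>S\<close>.
\<close>
definition infinitely_differentiable_on :: "(real \<Rightarrow> real) \<Rightarrow> real set \<Rightarrow> bool" where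
  "infinitely_differentiable_on f S \<longleftrightarrow> (\<forall>n. (deriv ^^ n) f differentiable_on S)"

end

theory Submission
  imports Defs
begin

text \<open>
  With \<open>F a b = (a + b) powr \<alpha> * u (a / (a + b))\<close> the equation is the 2-cocycle identity
  \<open>F a b + F (a + b) c = F a (b + c) + F b c\<close> on the positive reals. For \<open>a = w\<close> and \<open>b = 1 - w\<close> it
  expresses \<open>u w\<close> through the values of \<open>u\<close> at three points that move with a free parameter
  \<open>c \<in> {1..2}\<close>. As the superlevel sets of \<open>\<bar>u\<bar>\<close> shrink to measure zero, some \<open>c\<close> puts all three
  points where \<open>u\<close> is bounded; so \<open>u\<close> is locally bounded. Integrating over \<open>c\<close> then writes \<open>u\<close> in terms
  of a primitive of \<open>v \<mapsto> v powr (- \<alpha> - 2) * u v\<close>, and every application of this formula gains one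
  derivative.
\<close>

section \<open>Functions of class \<open>C\<^sup>k\<close> on an open set\<close>

text \<open>The derivative is an existential witness rather than \<open>deriv f\<close>, so closure
  lemmas can exhibit it by a formula. It is taken at \<open>x\<close> in the full line, which suits
  the open sets used below.\<close>

primrec Ck_on :: "nat \<Rightarrow> (real \<Rightarrow> real) \<Rightarrow> real set \<Rightarrow> bool" where
  "Ck_on 0 f S \<longleftrightarrow> continuous_on S f"
| "Ck_on (Suc k) f S \<longleftrightarrow> (\<exists>f'. (\<forall>x\<in>S. (f has_real_derivative f' x) (at x)) \<and> Ck_on k f' S)"

lemma Ck_on_SucI:
  assumes "\<And>x. x \<in> S \<Longrightarrow> (f has_real_derivative f' x) (at x)" "Ck_on k f' S"
  shows "Ck_on (Suc k) f S"
  using assms by auto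

lemma Ck_on_Suc_imp_continuous_on: "Ck_on (Suc k) f S \<Longrightarrow> continuous_on S f"
  by (meson Ck_on.simps(2) DERIV_isCont continuous_at_imp_continuous_on)

text \<open>Product and chain rule mention the original functions beside their derivatives, so those
  must be lowered by one order before the induction hypothesis applies.\<close>

lemma Ck_on_SucD: "Ck_on (Suc k) f S \<Longrightarrow> Ck_on k f S"
proof (induction k arbitrary: f)
  case 0
  then show ?case using Ck_on_Suc_imp_continuous_on[of 0 f S] by simp
next
  case (Suc k)
  from Suc.prems obtain f' where "\<forall>x\<in>S. (f has_real_derivative f' x) (at x)" "Ck_on (Suc k) f' S"
    by (metis Ck_on.simps(2))
  with Suc.IH[of f'] show ?case
    by (intro Ck_on_SucI[where f' = f']) auto
qed

lemma Ck_on_cong: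
  assumes "open S" "\<And>x. x \<in> S \<Longrightarrow> f x = g x" "Ck_on k f S"
  shows "Ck_on k g S"
proof (cases k)
  case 0
  with assms show ?thesis using continuous_on_cong[of S S f g] by simp
next
  case (Suc m)
  with assms(3) obtain f' where f': "\<forall>x\<in>S. (f has_real_derivative f' x) (at x)" "Ck_on m f' S"
    by auto
  have "(g has_real_derivative f' x) (at x)" if "x \<in> S" for x
    using has_field_derivative_transform_within_open[of f "f' x" x S g] assms that f' by auto
  with f' Suc show ?thesis by auto
qed

lemma Ck_on_subset:
  assumes "T \<subseteq> S" "Ck_on k f S"
  shows "Ck_on k f T"
  using assms(2)
proof (induction k arbitrary: f)
  case 0
  then show ?case using assms(1) continuous_on_subset by auto
next
  case (Suc k)
  then obtain f' where "\<forall>x\<in>S. (f has_real_derivative f' x) (at x)" "Ck_on k f' S"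
    by auto
  with Suc.IH[of f'] assms(1) show ?case
    by (intro Ck_on_SucI[where f' = f']) auto
qed

lemma Ck_on_const: "Ck_on k (\<lambda>x. c) S"
proof (induction k arbitrary: c)
  case (Suc k)
  show ?case by (rule Ck_on_SucI[where f' = "\<lambda>x. 0"]) (auto simp: Suc)
qed auto

lemma Ck_on_ident: "Ck_on k (\<lambda>x. x) S"
proof (cases k)
  case (Suc m)
  then show ?thesis by (auto intro!: exI[of _ "\<lambda>x. 1"] Ck_on_const)
qed auto

lemma Ck_on_add:
  assumes "Ck_on k f S" "Ck_on k g S"
  shows "Ck_on k (\<lambda>x. f x + g x) S"
  using assms
proof (induction k arbitrary: f g)
  case 0
  then show ?case by (auto intro: continuous_intros)
next
  case (Suc k)
  then obtain f' g' where "\<forall>x\<in>S. (f has_real_derivative f' x) (at x)" "Ck_on k f' S"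
    "\<forall>x\<in>S. (g has_real_derivative g' x) (at x)" "Ck_on k g' S"
    by auto
  with Suc.IH[of f' g'] show ?case
    by (intro Ck_on_SucI[where f' = "\<lambda>x. f' x + g' x"]) (auto intro!: derivative_eq_intros)
qed

lemma Ck_on_mult:
  assumes "Ck_on k f S" "Ck_on k g S"
  shows "Ck_on k (\<lambda>x. f x * g x) S"
  using assms
proof (induction k arbitrary: f g)
  case 0
  then show ?case by (auto intro: continuous_intros)
next
  case (Suc k)
  then obtain f' g' where d: "\<forall>x\<in>S. (f has_real_derivative f' x) (at x)" "Ck_on k f' S"
    "\<forall>x\<in>S. (g has_real_derivative g' x) (at x)" "Ck_on k g' S"
    by auto
  have "Ck_on k (\<lambda>x. f x * g' x + f' x * g x) S"
    using d Suc.prems by (intro Ck_on_add Suc.IH Ck_on_SucD[of k f] Ck_on_SucD[of k g])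
  with d show ?case
    by (intro Ck_on_SucI[where f' = "\<lambda>x. f x * g' x + f' x * g x"])
      (auto intro!: derivative_eq_intros)
qed

lemma Ck_on_diff:
  assumes "Ck_on k f S" "Ck_on k g S"
  shows "Ck_on k (\<lambda>x. f x - g x) S"
  using Ck_on_add[OF assms(1) Ck_on_mult[OF Ck_on_const[of k "-1"] assms(2)]] by simp

lemma Ck_on_compose:
  assumes "Ck_on k f T" "Ck_on k g S" "g ` S \<subseteq> T"
  shows "Ck_on k (\<lambda>x. f (g x)) S"
  using assms
proof (induction k arbitrary: f g)
  case 0
  then show ?case by (auto intro: continuous_on_compose2)
next
  case (Suc k)
  then obtain f' g' where d: "\<forall>x\<in>T. (f has_real_derivative f' x) (at x)" "Ck_on k f' T"
    "\<forall>x\<in>S. (g has_real_derivative g' x) (at x)" "Ck_on k g' S"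
    by auto
  have "Ck_on k (\<lambda>x. f' (g x) * g' x) S"
    using d Suc.IH[OF d(2) Ck_on_SucD[OF Suc.prems(2)] Suc.prems(3)] by (intro Ck_on_mult)
  moreover have "((\<lambda>x. f (g x)) has_real_derivative f' (g x) * g' x) (at x)" if "x \<in> S" for x
    using d that Suc.prems(3) by (intro DERIV_chain2[of f _ g]) auto
  ultimately show ?case
    by (rule Ck_on_SucI[rotated])
qed

lemma Ck_on_powr: "Ck_on k (\<lambda>x. x powr r) {0<..}"
proof (induction k arbitrary: r)
  case 0
  then show ?case by (auto intro!: continuous_intros)
next
  case (Suc k)
  show ?case
    by (rule Ck_on_SucI[where f' = "\<lambda>x. r * x powr (r - 1)"])
      (auto intro: Ck_on_mult Ck_on_const Suc has_real_derivative_powr)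
qed

lemma Ck_on_divide:
  assumes "Ck_on k f S" "Ck_on k g S" "\<And>x. x \<in> S \<Longrightarrow> 0 < g x" "open S"
  shows "Ck_on k (\<lambda>x. f x / g x) S"
proof (rule Ck_on_cong[OF assms(4)])
  \<comment> \<open>For positive \<open>g x\<close> the power with exponent -1 is the reciprocal, so
    products and compositions suffice.\<close>
  show "Ck_on k (\<lambda>x. f x * g x powr (-1)) S"
    using assms by (intro Ck_on_mult Ck_on_compose[OF Ck_on_powr]) auto
qed (use assms(3) in \<open>auto simp: powr_minus_divide less_imp_le\<close>)

lemma Ck_on_deriv:
  assumes "open S" "Ck_on (Suc k) f S"
  shows "Ck_on k (deriv f) S"
proof -
  obtain f' where f': "\<forall>x\<in>S. (f has_real_derivative f' x) (at x)" "Ck_on k f' S"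
    using assms(2) by auto
  show ?thesis
    by (rule Ck_on_cong[OF assms(1) _ f'(2)]) (use f'(1) in \<open>auto simp: DERIV_imp_deriv\<close>)
qed

lemma infinitely_differentiable_onI:
  assumes "open S" "\<And>k. Ck_on k f S"
  shows "infinitely_differentiable_on f S"
proof -
  \<comment> \<open>Each \<open>deriv\<close> costs one order, so \<open>k\<close> must stay
    arbitrary in the induction on \<open>n\<close>.\<close>
  have "Ck_on k ((deriv ^^ n) f) S" for k n
  proof (induction n arbitrary: k)
    case (Suc n)
    then show ?case
      using Ck_on_deriv[OF assms(1) Suc.IH[of "Suc k"]] by simp
  qed (simp add: assms)
  then have "Ck_on (Suc 0) ((deriv ^^ n) f) S" for n
    by blast
  then show ?thesis
    unfolding infinitely_differentiable_on_def Ck_on.simps differentiable_on_def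
    by (meson differentiable_at_withinI real_differentiable_def)
qed

section \<open>Images of sets of small measure\<close>

text \<open>Change of variables with the integrand 1: the measure of the image is the integral of
  \<open>\<bar>g' x\<bar>\<close> over \<open>S\<close>.\<close>

lemma measure_image_le_bounded_deriv:
  fixes g g' :: "real \<Rightarrow> real"
  assumes S: "S \<in> lmeasurable"
    and der: "\<And>x. x \<in> S \<Longrightarrow> (g has_field_derivative g' x) (at x within S)"
    and inj: "inj_on g S"
    and meas: "g' \<in> borel_measurable (lebesgue_on S)"
    and bound: "\<And>x. x \<in> S \<Longrightarrow> \<bar>g' x\<bar> \<le> B"
  shows "g ` S \<in> lmeasurable" "measure lebesgue (g ` S) \<le> B * measure lebesgue S"
proof -
  have SL: "S \<in> sets lebesgue"
    using S by blast
  have int: "(\<lambda>x. \<bar>g' x\<bar>) integrable_on S"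
    by (rule measurable_bounded_by_integrable_imp_integrable[where g = "\<lambda>x. B"])
      (use S SL bound meas in \<open>auto intro: integrable_on_const\<close>)
  then have "(\<lambda>x. \<bar>g' x\<bar> * 1) absolutely_integrable_on S"
    by (simp add: absolutely_integrable_on_iff_nonneg)
  then have img: "(\<lambda>x. 1::real) absolutely_integrable_on g ` S"
    "integral (g ` S) (\<lambda>x. 1) = integral S (\<lambda>x. \<bar>g' x\<bar> * 1)"
    using has_absolute_integral_change_of_variables_1'[OF SL der inj, where f = "\<lambda>x. 1"] by auto
  then show gS: "g ` S \<in> lmeasurable"
    by (simp add: lmeasurable_iff_integrable_on set_lebesgue_integral_eq_integral(1))
  have "measure lebesgue (g ` S) = integral S (\<lambda>x. \<bar>g' x\<bar>)"
    using img by (simp add: lmeasure_integral[OF gS])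
  also have "\<dots> \<le> integral S (\<lambda>x. B * 1)"
    using int S bound by (intro integral_le) (auto intro: integrable_on_const)
  also have "\<dots> = B * measure lebesgue S"
    by (simp only: integral_mult_right lmeasure_integral[OF S])
  finally show "measure lebesgue (g ` S) \<le> B * measure lebesgue S" .
qed

text \<open>The map inverts \<open>c\<close> to \<open>p / (q + c)\<close>, so the image consists of
  the parameters \<open>c\<close> that send this point into \<open>B\<close>. Its derivative has
  modulus p / v^2, at most 1 / l^2.\<close>

lemma measure_reciprocal_image_le:
  fixes p q l :: real
  assumes B: "B \<in> lmeasurable" "B \<subseteq> {l..}" and l: "0 < l" and p: "0 < p" "p \<le> 1"
  shows "(\<lambda>v. p / v - q) ` B \<in> lmeasurable"
    "measure lebesgue ((\<lambda>v. p / v - q) ` B) \<le> measure lebesgue B / l\<^sup>2"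
proof -
  have pos: "0 < v" "l \<le> v" if "v \<in> B" for v
    using that B(2) l by auto
  have *: "((\<lambda>v. p / v - q) has_field_derivative (- p / v\<^sup>2)) (at v within B)" if "v \<in> B" for v
    using pos[OF that] by (auto intro!: derivative_eq_intros simp: power2_eq_square)
  have inj: "inj_on (\<lambda>v. p / v - q) B"
    using pos p by (fastforce simp: inj_on_def field_simps)
  have "continuous_on B (\<lambda>v. - p / v\<^sup>2)"
    using pos by (intro continuous_intros) fastforce
  then have meas: "(\<lambda>v. - p / v\<^sup>2) \<in> borel_measurable (lebesgue_on B)"
    using B(1) by (intro continuous_imp_measurable_on_sets_lebesgue) (auto dest: fmeasurableD)
  have bound: "\<bar>- p / v\<^sup>2\<bar> \<le> 1 / l\<^sup>2" if "v \<in> B" for v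
  proof -
    have "p / v\<^sup>2 \<le> 1 / l\<^sup>2"
      using pos[OF that] l p by (intro frac_le power_mono) auto
    then show ?thesis using p by simp
  qed
  show "(\<lambda>v. p / v - q) ` B \<in> lmeasurable"
    "measure lebesgue ((\<lambda>v. p / v - q) ` B) \<le> measure lebesgue B / l\<^sup>2"
    using measure_image_le_bounded_deriv[OF B(1) * inj meas bound] by auto
qed

text \<open>Continuity of the measure from above: the sets decrease, have finite measure, and have
  empty intersection because \<open>u\<close> takes real values.\<close>

lemma measure_superlevel_tendsto_0:
  fixes u :: "real \<Rightarrow> real"
  assumes I: "I \<in> lmeasurable" and u: "u \<in> borel_measurable (lebesgue_on I)"
  shows "\<And>n::nat. {v \<in> I. real n < \<bar>u v\<bar>} \<in> lmeasurable"
    and "(\<lambda>n. measure lebesgue {v \<in> I. real n < \<bar>u v\<bar>}) \<longlonglongrightarrow> 0"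
proof -
  let ?B = "\<lambda>n::nat. {v \<in> I. real n < \<bar>u v\<bar>}"
  have "{v \<in> space (lebesgue_on I). real n < \<bar>u v\<bar>} \<in> sets (lebesgue_on I)" for n :: nat
    using u by measurable
  then have meas: "?B n \<in> sets lebesgue" for n
    using I by (auto simp: sets_restrict_space_iff fmeasurableD)
  then show lm: "?B n \<in> lmeasurable" for n :: nat
    using I by (intro fmeasurableI2[OF I]) auto
  have "(\<lambda>n. measure lebesgue (?B n)) \<longlonglongrightarrow> measure lebesgue (\<Inter>n. ?B n)"
  proof (rule Lim_measure_decseq)
    show "decseq ?B"
      by (auto simp: decseq_def)
    show "emeasure lebesgue (?B n) \<noteq> \<infinity>" for n
      using fmeasurableD2[OF lm, of n] by simp
  qed (use meas in auto)
  moreover have "(\<Inter>n. ?B n) = {}"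
  proof -
    have "x \<notin> (\<Inter>n. ?B n)" for x
    proof -
      obtain n where "\<bar>u x\<bar> < real n"
        using reals_Archimedean2 by blast
      then have "x \<notin> ?B n"
        by simp
      then show ?thesis
        by blast
    qed
    then show ?thesis
      by blast
  qed
  ultimately show "(\<lambda>n. measure lebesgue (?B n)) \<longlonglongrightarrow> 0"
    by simp
qed

section \<open>The cocycle identity and its consequences\<close>

text \<open>The triple (w, 1 - w, c) of the cocycle identity, scaled to total 1, gives x = c / (1 +
  c) and y = w / (1 + c). Multiplying the equation by (1 + c)^\<alpha> and solving for
  \<open>u w\<close> gives the claim.\<close>

lemma cocycle_identity:
  fixes \<alpha> :: real and u :: "real \<Rightarrow> real"
  assumes eq: "\<And>x y. x \<in> {0..<1} \<Longrightarrow> y \<in> {0..<1} \<Longrightarrow> x + y \<in> {0..1} \<Longrightarrow>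
           u (1 - x) + (1 - x) powr \<alpha> * u (y / (1 - x)) =
           u y + (1 - y) powr \<alpha> * u ((1 - x - y) / (1 - y))"
    and w: "w \<in> {0<..<1}" and c: "0 < c"
  shows "u w = (1 + c) powr \<alpha> * u (w / (1 + c))
    + (1 - w + c) powr \<alpha> * u ((1 - w) / (1 - w + c)) - (1 + c) powr \<alpha> * u (1 / (1 + c))"
proof -
  let ?x = "c / (1 + c)" and ?y = "w / (1 + c)"
  have e: "1 - ?x = 1 / (1 + c)" "?y / (1 - ?x) = w" "1 - ?y = (1 - w + c) / (1 + c)"
    using c by (auto simp: field_simps)
  have "1 - ?x - ?y = (1 - w) / (1 + c)"
    using c by (simp add: field_simps)
  then have e4: "(1 - ?x - ?y) / (1 - ?y) = (1 - w) / (1 - w + c)"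
    using c by (simp add: e(3))
  have "u (1 - ?x) + (1 - ?x) powr \<alpha> * u (?y / (1 - ?x)) =
        u ?y + (1 - ?y) powr \<alpha> * u ((1 - ?x - ?y) / (1 - ?y))"
  proof (rule eq)
    show "?x \<in> {0..<1}" "?y \<in> {0..<1}"
      using w c by (auto simp: field_simps)
    show "?x + ?y \<in> {0..1}"
      unfolding add_divide_distrib[symmetric] using w c by auto
  qed
  then have "u (1 / (1 + c)) + (1 / (1 + c)) powr \<alpha> * u w =
        u ?y + ((1 - w + c) / (1 + c)) powr \<alpha> * u ((1 - w) / (1 - w + c))"
    unfolding e4 e(2) unfolding e .
  then have "u (1 / (1 + c)) + u w / (1 + c) powr \<alpha> =
        u ?y + (1 - w + c) powr \<alpha> / (1 + c) powr \<alpha> * u ((1 - w) / (1 - w + c))"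
    using w c by (simp add: powr_divide)
  moreover have "(1 + c) powr \<alpha> > 0"
    using c by simp
  ultimately show ?thesis
    by (simp add: field_simps)
qed

section \<open>Local boundedness of measurable solutions\<close>

locale measurable_cocycle =
  fixes \<alpha> :: real and u :: "real \<Rightarrow> real"
  assumes pos: "0 < \<alpha>"
    and meas: "u \<in> borel_measurable (lebesgue_on {0..1})"
    and cocycle: "\<And>w c. w \<in> {0<..<1} \<Longrightarrow> 0 < c \<Longrightarrow>
      u w = (1 + c) powr \<alpha> * u (w / (1 + c))
        + (1 - w + c) powr \<alpha> * u ((1 - w) / (1 - w + c)) - (1 + c) powr \<alpha> * u (1 / (1 + c))"
begin

lemma meas_on: "0 \<le> a \<Longrightarrow> b \<le> 1 \<Longrightarrow> u \<in> borel_measurable (lebesgue_on {a..b})"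
  by (rule measurable_restrict_mono[OF meas]) auto

lemma locally_bounded:
  assumes \<delta>: "0 < \<delta>"
  shows "\<exists>C. \<forall>w\<in>{\<delta>..1 - \<delta>}. \<bar>u w\<bar> \<le> C"
proof (cases "\<delta> \<le> 1 / 2")
  case False
  then show ?thesis by auto
next
  case \<delta>2: True
  \<comment> \<open>The three points have the form p / (q + c) with p at least \<delta> and q + c at
    most 3, so they are at least \<open>l\<close>. They are at most 1/2 because c is at least
    1.\<close>
  define l where "l = \<delta> / 3"
  have l: "0 < l" using \<delta> by (simp add: l_def)
  let ?I = "{l..1 / 2}" and ?B = "\<lambda>n::nat. {v \<in> {l..1 / 2}. real n < \<bar>u v\<bar>}"
  have "u \<in> borel_measurable (lebesgue_on ?I)"
    using l by (intro meas_on) auto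
  note B = measure_superlevel_tendsto_0[OF _ this]
  \<comment> \<open>Passing to parameters enlarges measure by at most 1 / l^2, so each of the three
    bad sets gets measure below 1/3. This \<open>n\<close> does not depend on \<open>w\<close>,
    which makes the bound uniform.\<close>
  have "eventually (\<lambda>n. measure lebesgue (?B n) < l\<^sup>2 / 3) sequentially"
    using l by (intro order_tendstoD(2)[OF B(2)]) auto
  then obtain n where n: "measure lebesgue (?B n) < l\<^sup>2 / 3"
    using eventually_happens'[OF sequentially_bot] by blast
  have small: "(\<lambda>v. p / v - q) ` ?B n \<in> lmeasurable \<and>
      measure lebesgue ((\<lambda>v. p / v - q) ` ?B n) < 1 / 3" if "0 < p" "p \<le> 1" for p q
  proof -
    have "measure lebesgue (?B n) / l\<^sup>2 < 1 / 3"
      using n l by (simp add: field_simps)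
    moreover have "?B n \<subseteq> {l..}"
      by auto
    note measure_reciprocal_image_le[OF B(1)[OF lmeasurable_interval(1)] this l that, of q]
    ultimately show ?thesis
      by (meson le_less_trans)
  qed
  have "\<bar>u w\<bar> \<le> 3 powr \<alpha> * real n + 3 powr \<alpha> * real n + 3 powr \<alpha> * real n"
    if w: "w \<in> {\<delta>..1 - \<delta>}" for w
  proof -
    \<comment> \<open>The bad parameters for the point p / (q + c). The pairs (p, q) used are (w,
      1), (1 - w, 1 - w) and (1, 1).\<close>
    define T where "T p q = (\<lambda>v. p / v - q) ` ?B n" for p q
    have w01: "0 < w" "w < 1" using w \<delta> by auto
    note s = small[of w 1, folded T_def] small[of "1 - w" "1 - w", folded T_def]
      small[of 1 1, folded T_def]
    let ?T = "T w 1 \<union> T (1 - w) (1 - w) \<union> T 1 1"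
    have sets: "T w 1 \<in> sets lebesgue" "T (1 - w) (1 - w) \<in> sets lebesgue" "T 1 1 \<in> sets lebesgue"
      using s w01 by (auto dest: fmeasurableD)
    have "measure lebesgue ?T \<le> measure lebesgue (T w 1 \<union> T (1 - w) (1 - w))
        + measure lebesgue (T 1 1)"
      using sets by (intro measure_Un_le) auto
    also have "\<dots> \<le> measure lebesgue (T w 1) + measure lebesgue (T (1 - w) (1 - w))
        + measure lebesgue (T 1 1)"
      using sets by (intro add_right_mono measure_Un_le)
    also have "\<dots> < 1"
      using s w01 by auto
    finally have lt: "measure lebesgue ?T < 1" .
    \<comment> \<open>The interval has length 1, more than all bad parameters together.\<close>
    have "\<not> {1..2} \<subseteq> ?T"
    proof
      assume "{1..2} \<subseteq> ?T"
      then have "measure lebesgue {1..2::real} \<le> measure lebesgue ?T"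
        using s w01 by (intro measure_mono_fmeasurable fmeasurable.Un) auto
      with lt show False by simp
    qed
    then obtain c where "c \<in> {1..2}" "c \<notin> ?T"
      by blast
    then have c: "1 \<le> c" "c \<le> 2" "c \<notin> T w 1" "c \<notin> T (1 - w) (1 - w)" "c \<notin> T 1 1"
      by auto
    have bd: "\<bar>u (p / (q + c))\<bar> \<le> real n"
      if "c \<notin> T p q" "0 < p" "0 \<le> q" "\<delta> \<le> p" "p \<le> q + c - p" "q \<le> 1" for p q
    proof (rule ccontr)
      assume "\<not> \<bar>u (p / (q + c))\<bar> \<le> real n"
      moreover have "q + c > 0" using that c by simp
      moreover have "\<delta> * (q + c) \<le> p * 3"
        using that c \<delta> by (intro mult_mono) auto
      then have "l \<le> p / (q + c)"
        using \<open>q + c > 0\<close> by (simp add: l_def field_simps)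
      moreover have "p / (q + c) \<le> 1 / 2"
        using that \<open>q + c > 0\<close> by (simp add: field_simps)
      ultimately have "p / (q + c) \<in> ?B n" by auto
      then have "p / (p / (q + c)) - q \<in> T p q"
        unfolding T_def by (rule imageI)
      with that c show False by simp
    qed
    have b: "\<bar>u (w / (1 + c))\<bar> \<le> real n" "\<bar>u ((1 - w) / (1 - w + c))\<bar> \<le> real n"
      "\<bar>u (1 / (1 + c))\<bar> \<le> real n"
      using w w01 \<delta>2 c by (auto intro!: bd)
    \<comment> \<open>The bases 1 + c and 1 - w + c are at most 3, and \<alpha> is positive.\<close>
    have prod: "\<bar>r powr \<alpha> * t\<bar> \<le> 3 powr \<alpha> * real n" if "0 \<le> r" "r \<le> 3" "\<bar>t\<bar> \<le> real n" for r t
      unfolding abs_mult using that pos by (intro mult_mono) (auto intro: powr_mono2)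
    have "\<bar>(1 + c) powr \<alpha> * u (w / (1 + c))\<bar> \<le> 3 powr \<alpha> * real n"
      "\<bar>(1 - w + c) powr \<alpha> * u ((1 - w) / (1 - w + c))\<bar> \<le> 3 powr \<alpha> * real n"
      "\<bar>(1 + c) powr \<alpha> * u (1 / (1 + c))\<bar> \<le> 3 powr \<alpha> * real n"
      using b w01 c by (auto intro!: prod)
    moreover have "u w = (1 + c) powr \<alpha> * u (w / (1 + c))
        + (1 - w + c) powr \<alpha> * u ((1 - w) / (1 - w + c)) - (1 + c) powr \<alpha> * u (1 / (1 + c))"
      using w01 c by (intro cocycle) auto
    ultimately show ?thesis
      by linarith
  qed
  then show ?thesis by blast
qed

section \<open>The integral representation of u\<close>

definition f :: "real \<Rightarrow> real" where "f v = v powr (- \<alpha> - 2) * u v"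

text \<open>With v = p / (q + c) one has (q + c)^\<alpha> = p^\<alpha> v^(-\<alpha>) and dc = -p
  v^(-2) dv, whence the exponent -\<alpha> - 2 in \<open>f\<close>. The primitive is based at 1/2,
  an upper bound for all these points, so the integral stays away from the possible singularities of
  \<open>f\<close> at 0 and 1.\<close>

definition M :: "real \<Rightarrow> real" where "M x = integral {x..1 / 2} f"

text \<open>Local boundedness enters here: \<open>u\<close> is bounded and measurable on the
  interval, and the power weight is continuous.\<close>

lemma f_absolutely_integrable:
  assumes "0 < a" "b < 1"
  shows "f absolutely_integrable_on {a..b}"
proof -
  define \<delta> where "\<delta> = min a (1 - b)"
  have "0 < \<delta>" using assms by (simp add: \<delta>_def)
  then obtain C where C: "\<forall>w\<in>{\<delta>..1 - \<delta>}. \<bar>u w\<bar> \<le> C"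
    using locally_bounded by blast
  have "{a..b} \<subseteq> {\<delta>..1 - \<delta>}" by (auto simp: \<delta>_def)
  with C have "bounded (u ` {a..b})"
    unfolding bounded_iff by (intro exI[of _ C]) auto
  moreover have "(\<lambda>v. v powr (- \<alpha> - 2)) absolutely_integrable_on {a..b}"
    using assms by (intro absolutely_integrable_continuous_real) (auto intro!: continuous_intros)
  ultimately have "(\<lambda>v. u v * v powr (- \<alpha> - 2)) absolutely_integrable_on {a..b}"
    using assms by (intro absolutely_integrable_bounded_measurable_product_real meas_on) auto
  then show ?thesis
    by (simp add: f_def[abs_def] mult.commute)
qed

lemma f_integrable: "0 < a \<Longrightarrow> b < 1 \<Longrightarrow> f integrable_on {a..b}"
  using f_absolutely_integrable set_lebesgue_integral_eq_integral(1) by blast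

lemma integral_f_eq:
  assumes "0 < a" "a \<le> b" "b \<le> 1 / 2"
  shows "integral {a..b} f = M a - M b"
  using Henstock_Kurzweil_Integration.integral_combine[OF assms(2,3) f_integrable] assms by (simp add: M_def)

text \<open>The substitution \<open>v = p / (q + c)\<close> turns each term of the cocycle identity, integrated over
  \<open>c \<in> {1..2}\<close>, into an increment of \<^term>\<open>M\<close>.\<close>

lemma cocycle_term_has_integral:
  assumes p: "0 < p" "0 \<le> q" "p \<le> q + 1 - p"
  shows "((\<lambda>c. (q + c) powr \<alpha> * u (p / (q + c))) has_integral
    p powr (\<alpha> + 1) * (M (p / (q + 2)) - M (p / (q + 1)))) {1..2}"
proof -
  let ?g = "\<lambda>c. p / (q + c)" and ?J = "{p / (q + 2)..p / (q + 1)}"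
  have img: "?g ` {1..2} = ?J"
  proof (intro equalityI subsetI)
    fix v assume "v \<in> ?g ` {1..2}"
    then show "v \<in> ?J" using p by (auto intro!: divide_left_mono)
  next
    fix v assume v: "v \<in> ?J"
    have "0 < p / (q + 2)" using p by simp
    with v have v0: "0 < v" by auto
    have "p / v - q \<in> {1..2}" using v v0 p by (auto simp: field_simps)
    moreover have "v = ?g (p / v - q)" using v0 p by simp
    ultimately show "v \<in> ?g ` {1..2}" by blast
  qed
  have der: "(?g has_field_derivative (- p / (q + c)\<^sup>2)) (at c within {1..2})" if "c \<in> {1..2}" for c
    using that p by (auto intro!: derivative_eq_intros simp: power2_eq_square)
  have inj: "inj_on ?g {1..2}"
    using p by (auto simp: inj_on_def field_simps)
  \<comment> \<open>The hypothesis \<open>p \<le> q + 1 - p\<close> says exactly that the right end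
    of \<open>?J\<close> is at most 1/2, the base point of \<open>M\<close>.\<close>
  have half: "p / (q + 1) \<le> 1 / 2" "p / (q + 2) \<le> p / (q + 1)" "0 < p / (q + 2)"
    using p by (auto simp: field_simps)
  from half(1) have "p / (q + 1) < 1"
    by (rule le_less_trans) simp
  with half have "f absolutely_integrable_on ?J"
    by (intro f_absolutely_integrable)
  moreover have "integral ?J f = M (p / (q + 2)) - M (p / (q + 1))"
    using half by (intro integral_f_eq)
  ultimately have "(\<lambda>c. \<bar>- p / (q + c)\<^sup>2\<bar> * f (?g c)) absolutely_integrable_on {1..2} \<and>
      integral {1..2} (\<lambda>c. \<bar>- p / (q + c)\<^sup>2\<bar> * f (?g c)) = M (p / (q + 2)) - M (p / (q + 1))"
    using has_absolute_integral_change_of_variables_1'[OF _ der inj, where f = f] unfolding img by simp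
  then have "((\<lambda>c. \<bar>- p / (q + c)\<^sup>2\<bar> * f (?g c)) has_integral M (p / (q + 2)) - M (p / (q + 1))) {1..2}"
    using set_lebesgue_integral_eq_integral(1) has_integral_integral by metis
  from has_integral_mult_right[OF this, of "p powr (\<alpha> + 1)"]
  show ?thesis
  proof (rule has_integral_eq[rotated])
    fix c :: real assume "c \<in> {1..2}"
    then have qc: "0 < q + c" using p by auto
    have "\<bar>- p / (q + c)\<^sup>2\<bar> = p powr 1 * (q + c) powr (-2)"
      using qc p by (simp add: powr_minus_divide)
    moreover have "f (?g c) = p powr (- \<alpha> - 2) * (q + c) powr (\<alpha> + 2) * u (?g c)"
    proof -
      have "(p / (q + c)) powr (- \<alpha> - 2) = p powr (- \<alpha> - 2) / (q + c) powr (- (\<alpha> + 2))"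
        using qc p by (simp add: powr_divide)
      also have "\<dots> = p powr (- \<alpha> - 2) * (q + c) powr (\<alpha> + 2)"
        by (subst powr_minus) (simp add: divide_inverse)
      finally show ?thesis by (simp add: f_def)
    qed
    \<comment> \<open>The factor p^(\<alpha> + 1) is chosen so that the powers of \<open>p\<close>
      cancel: the exponents \<alpha> + 1, 1 and -\<alpha> - 2 add up to 0.\<close>
    ultimately have "p powr (\<alpha> + 1) * (\<bar>- p / (q + c)\<^sup>2\<bar> * f (?g c)) =
        (p powr (\<alpha> + 1) * p powr 1 * p powr (- \<alpha> - 2)) * ((q + c) powr (-2) * (q + c) powr (\<alpha> + 2))
          * u (?g c)"
      by (simp only: mult_ac)
    also have "p powr (\<alpha> + 1) * p powr 1 * p powr (- \<alpha> - 2) = 1"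
      unfolding powr_add[symmetric] using p by simp
    also have "(q + c) powr (-2) * (q + c) powr (\<alpha> + 2) = (q + c) powr \<alpha>"
      unfolding powr_add[symmetric] by simp
    finally show "p powr (\<alpha> + 1) * (\<bar>- p / (q + c)\<^sup>2\<bar> * f (?g c)) = (q + c) powr \<alpha> * u (?g c)"
      by simp
  qed
qed

text \<open>The cocycle identity is integrated over c in {1..2}. Its left side is constant in c and
  the interval has length 1, so \<open>u w\<close> itself results.\<close>

lemma u_eq:
  assumes w: "w \<in> {0<..<1}"
  shows "u w = w powr (\<alpha> + 1) * (M (w / 3) - M (w / 2))
    + (1 - w) powr (\<alpha> + 1) * (M ((1 - w) / (3 - w)) - M ((1 - w) / (2 - w)))
    - (M (1 / 3) - M (1 / 2))"
proof -
  have "((\<lambda>c. (1 + c) powr \<alpha> * u (w / (1 + c))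
        + (1 - w + c) powr \<alpha> * u ((1 - w) / (1 - w + c)) - (1 + c) powr \<alpha> * u (1 / (1 + c)))
      has_integral (w powr (\<alpha> + 1) * (M (w / (1 + 2)) - M (w / (1 + 1)))
    + (1 - w) powr (\<alpha> + 1) * (M ((1 - w) / (1 - w + 2)) - M ((1 - w) / (1 - w + 1)))
    - 1 powr (\<alpha> + 1) * (M (1 / (1 + 2)) - M (1 / (1 + 1))))) {1..2}" (is "(_ has_integral ?R) _")
    using w by (intro has_integral_add has_integral_diff cocycle_term_has_integral) auto
  moreover have "u w = (1 + c) powr \<alpha> * u (w / (1 + c))
      + (1 - w + c) powr \<alpha> * u ((1 - w) / (1 - w + c)) - (1 + c) powr \<alpha> * u (1 / (1 + c))"
    if "c \<in> {1..2}" for c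
    using that by (intro cocycle[OF w]) auto
  ultimately have "((\<lambda>c. u w) has_integral ?R) {1..2::real}"
    by (subst has_integral_cong)
  moreover have "((\<lambda>c. u w) has_integral u w) {1..2::real}"
    using has_integral_const_real[of "u w" 1 2] by simp
  ultimately have "u w = ?R"
    by (rule has_integral_unique[rotated])
  moreover have "1 - w + 2 = 3 - w" "1 - w + 1 = 2 - w"
    by simp_all
  ultimately show ?thesis
    by simp
qed

section \<open>Bootstrapping regularity\<close>

lemma Ck_on_u_if_Ck_on_M:
  assumes "Ck_on k M {0<..<1 / 2}"
  shows "Ck_on k u {0<..<1}"
proof (rule Ck_on_cong[OF _ u_eq[symmetric]])
  show "Ck_on k (\<lambda>w. w powr (\<alpha> + 1) * (M (w / 3) - M (w / 2))
    + (1 - w) powr (\<alpha> + 1) * (M ((1 - w) / (3 - w)) - M ((1 - w) / (2 - w)))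
    - (M (1 / 3) - M (1 / 2))) {0<..<1}"
    \<comment> \<open>For w in (0, 1) all four moving arguments of \<open>M\<close> lie in (0, 1/2).
      The last bracket, which contains \<open>M (1 / 2)\<close>, is a constant.\<close>
    by (intro Ck_on_add Ck_on_diff Ck_on_mult Ck_on_const Ck_on_compose[OF Ck_on_powr]
        Ck_on_compose[OF assms] Ck_on_divide Ck_on_ident)
      (auto simp: divide_less_eq)
qed auto

text \<open>The start of the bootstrap: an indefinite integral is continuous even before
  \<open>u\<close> is known to be.\<close>

lemma continuous_on_M: "continuous_on {0<..<1 / 2} M"
proof -
  have "continuous (at x) M" if "x \<in> {0<..<1 / 2}" for x
  proof -
    have "continuous_on {x / 2..1 / 2} M"
      unfolding M_def using that by (intro indefinite_integral_continuous_1' f_integrable) auto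
    then show ?thesis
      using that by (intro continuous_on_interior[of "{x / 2..1 / 2}"]) auto
  qed
  then show ?thesis
    by (simp add: continuous_at_imp_continuous_on)
qed

lemma M_has_derivative:
  assumes u: "continuous_on {0<..<1} u" and x: "x \<in> {0<..<1 / 2}"
  shows "(M has_real_derivative - f x) (at x)"
proof -
  have "continuous_on {x / 2..1 / 2} f"
    unfolding f_def[abs_def] using x
    by (intro continuous_intros continuous_on_subset[OF u]) auto
  then have "(M has_real_derivative - f x) (at x within {x / 2..1 / 2})"
    unfolding M_def using x by (intro integral_has_real_derivative') auto
  \<comment> \<open>The left end x / 2 was chosen to make \<open>x\<close> an interior point, so the
    one-interval derivative is the full one.\<close>
  then show ?thesis
    using x at_within_interior[of x "{x / 2..1 / 2}"] by auto
qed

lemma Ck_on_u: "Ck_on k u {0<..<1}"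
proof (induction k)
  case 0
  show ?case by (rule Ck_on_u_if_Ck_on_M) (simp add: continuous_on_M)
next
  case (Suc k)
  \<comment> \<open>The fundamental theorem of calculus needs \<open>u\<close> continuous in order
    to differentiate \<open>M\<close>.\<close>
  have "Ck_on 0 u {0<..<1}"
    by (rule Ck_on_u_if_Ck_on_M) (simp add: continuous_on_M)
  then have u: "continuous_on {0<..<1} u"
    by simp
  have "Ck_on k u {0<..<1 / 2}"
    by (rule Ck_on_subset[OF _ Suc]) auto
  moreover have "Ck_on k (\<lambda>v. v powr (- \<alpha> - 2)) {0<..<1 / 2}"
    by (rule Ck_on_subset[OF _ Ck_on_powr]) auto
  \<comment> \<open>Writing the derivative of \<open>M\<close> as a difference lets
    \<open>Ck_on_diff\<close> apply.\<close>
  ultimately have "Ck_on k (\<lambda>v. 0 - f v) {0<..<1 / 2}"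
    unfolding f_def by (intro Ck_on_diff Ck_on_const Ck_on_mult)
  then have "Ck_on (Suc k) M {0<..<1 / 2}"
    using M_has_derivative[OF u] by (intro Ck_on_SucI[where f' = "\<lambda>v. 0 - f v"]) auto
  then show ?case
    by (rule Ck_on_u_if_Ck_on_M)
qed

end

theorem theorem1p2:
  fixes \<alpha> :: real and u :: "real \<Rightarrow> real"
  assumes "\<alpha> > 0"
    and "u \<in> borel_measurable (lebesgue_on {0..1})"
    and "\<And>x y. x \<in> {0..<1} \<Longrightarrow> y \<in> {0..<1} \<Longrightarrow> x + y \<in> {0..1} \<Longrightarrow>
           u (1 - x) + (1 - x) powr \<alpha> * u (y / (1 - x)) =
           u y + (1 - y) powr \<alpha> * u ((1 - x - y) / (1 - y))"
  shows "infinitely_differentiable_on u {0<..<1}"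
proof -
  interpret measurable_cocycle \<alpha> u
  proof
    show "u w = (1 + c) powr \<alpha> * u (w / (1 + c))
        + (1 - w + c) powr \<alpha> * u ((1 - w) / (1 - w + c)) - (1 + c) powr \<alpha> * u (1 / (1 + c))"
      if "w \<in> {0<..<1}" "0 < c" for w c
      using assms(3) that by (rule cocycle_identity)
  qed (use assms(1,2) in auto)
  show ?thesis
    by (intro infinitely_differentiable_onI Ck_on_u) auto
qed

end
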